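(* Let $\mathfrak L(z)=-z^{-1}\log(1-z)=\sum_{j=0}^\infty\frac{z^j}{j+1}$, $z\in\mathbb D$, and for $n\ge1$ let $$\mathfrak g_n^L(z):=\frac{1}{\mathfrak L(z)}\sum_{j=0}^{n-1}\frac{z^j}{j+1}.$$ Then: (i) there is $M>0$, independent of $n$, such that $\|\mathfrak g_n^L\|_{A^\alpha(\mathbb D)}\le M$ for every $n\ge1$ and every $0\le\alpha\le1$; (ii) $\lim_{n\to\infty}(1-z)\mathfrak g_n^L(z)=1-z$ in $A^\alpha(\mathbb D)$ for every $0\le\alpha<1$.
   Context: For $\alpha\in\mathbb R$: $k^\alpha(0)=1$, $k^\alpha(n)=\frac{\alpha(\alpha+1)\cdots(\alpha+n-1)}{n!}$ for $n\ge1$. For $\alpha\ge0$ put $W^{-\alpha}f(n)=\sum_{j=n}^\infty k^{\alpha}(j-n)f(j)$. $A^\alpha(\mathbb D)$ is the Banach algebra of functions $\mathfrak h(z)=\sum_{n\ge0} h(n)z^n$ with $h\in\ell^1$ such that $h=W^{-\alpha}u$ for some (unique) sequence $u$ with $\sum_n|u(n)|k^{\alpha+1}(n)<\infty$; one writes $u=W^\alpha h$ (it equals $D^\alpha h(n)=\sum_{j\ge n}k^{-\alpha}(j-n)h(j)$), and the norm is $\|\mathfrak h\|_{A^\alpha(\mathbb D)}=\sum_n|W^\alpha h(n)|k^{\alpha+1}(n)$. The function $1/\mathfrak L$ is extended continuously to $\overline{\mathbb D}$ (with value $0$ at $z=1$). *)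

theory Defs
  imports "HOL-Analysis.Analysis"
begin

definition cesaro_k :: "real \<Rightarrow> nat \<Rightarrow> real" where
  "cesaro_k \<alpha> n = pochhammer \<alpha> n / fact n"

text \<open>The sum over \<open>j \<ge> n\<close> is reindexed by \<open>i = j - n\<close>. It converges absolutely for
  \<open>\<alpha> \<ge> 0\<close> and \<open>f\<close> summable against \<open>cesaro_k (\<alpha> + 1)\<close>.\<close>

definition W_minus :: "real \<Rightarrow> (nat \<Rightarrow> complex) \<Rightarrow> nat \<Rightarrow> complex" where
  "W_minus \<alpha> f n = (\<Sum>i. of_real (cesaro_k \<alpha> i) * f (n + i))"

definition is_W_deriv :: "real \<Rightarrow> (nat \<Rightarrow> complex) \<Rightarrow> (nat \<Rightarrow> complex) \<Rightarrow> bool" where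
  "is_W_deriv \<alpha> h u \<longleftrightarrow>
     summable (\<lambda>n. norm (u n) * cesaro_k (\<alpha> + 1) n) \<and> h = W_minus \<alpha> u"

definition W_plus :: "real \<Rightarrow> (nat \<Rightarrow> complex) \<Rightarrow> nat \<Rightarrow> complex" where
  "W_plus \<alpha> h = (THE u. is_W_deriv \<alpha> h u)"

text \<open>Functions are regarded on the closed unit disc only; their values elsewhere are irrelevant.\<close>

definition has_l1_coeffs :: "(complex \<Rightarrow> complex) \<Rightarrow> (nat \<Rightarrow> complex) \<Rightarrow> bool" where
  "has_l1_coeffs f h \<longleftrightarrow>
     summable (\<lambda>n. norm (h n)) \<and> (\<forall>z\<in>cball 0 1. (\<lambda>n. h n * z ^ n) sums f z)"

definition l1_coeffs :: "(complex \<Rightarrow> complex) \<Rightarrow> nat \<Rightarrow> complex" where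
  "l1_coeffs f = (THE h. has_l1_coeffs f h)"

definition A_space :: "real \<Rightarrow> (complex \<Rightarrow> complex) set" where
  "A_space \<alpha> = {f. \<exists>h u. has_l1_coeffs f h \<and> is_W_deriv \<alpha> h u}"

definition A_norm :: "real \<Rightarrow> (complex \<Rightarrow> complex) \<Rightarrow> real" where
  "A_norm \<alpha> f = (\<Sum>n. norm (W_plus \<alpha> (l1_coeffs f) n) * cesaro_k (\<alpha> + 1) n)"

definition frakL :: "complex \<Rightarrow> complex" where
  "frakL z = (if z = 0 then 1 else - (Ln (1 - z) / z))"

lemma frakL_sums:
  assumes "norm z < 1"
  shows "(\<lambda>j. z ^ j / of_nat (j + 1)) sums frakL z"
proof (cases "z = 0")
  case True
  have "(\<lambda>j. (1 / of_nat (j + 1)) * (0::complex) ^ j) sums (1 / of_nat (0 + 1))"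
    by (rule powser_sums_zero)
  with True show ?thesis by (simp add: frakL_def)
next
  case False
  have "(\<lambda>n. - (z ^ n) / of_nat n) sums Ln (1 - z)"
    using Ln_series'[of "- z"] assms by simp
  hence "(\<lambda>n. - (z ^ Suc n) / of_nat (Suc n)) sums Ln (1 - z)"
    by (subst sums_Suc_iff) simp
  hence "(\<lambda>n. (- (1 / z)) * (- (z ^ Suc n) / of_nat (Suc n))) sums ((- (1 / z)) * Ln (1 - z))"
    by (rule sums_mult)
  with False show ?thesis by (simp add: frakL_def)
qed

text \<open>The continuous extension of \<open>1 / frakL\<close> from the open to the closed unit disc.\<close>

definition inv_frakL :: "complex \<Rightarrow> complex" where
  "inv_frakL z =
     (if z \<in> ball 0 1 then 1 / frakL z else Lim (at z within ball 0 1) (\<lambda>w. 1 / frakL w))"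

lemma inv_frakL_closed_disc:
  assumes "norm z \<le> 1"
  shows "inv_frakL z = (if z = 1 then 0 else 1 / frakL z)"
    and "((\<lambda>w. 1 / frakL w) \<longlongrightarrow> inv_frakL z) (at z within ball 0 1)"
proof -
  have ntriv: "at z within ball 0 1 \<noteq> bot"
  proof -
    have "z islimpt ball 0 1"
      using assms islimpt_ball[of z "0::complex" 1] by simp
    thus ?thesis by (simp add: trivial_limit_within)
  qed
  have lim: "((\<lambda>w. 1 / frakL w) \<longlongrightarrow> (if z = 1 then 0 else 1 / frakL z)) (at z within ball 0 1)"
  proof (cases "z = 1")
    case True
    have t0: "((\<lambda>w. 1 - w) \<longlongrightarrow> 0) (at (1::complex) within ball 0 1)"
      by (auto intro!: tendsto_eq_intros)
    have nz: "eventually (\<lambda>w. 1 - w \<noteq> 0) (at (1::complex) within ball 0 1)"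
      by (auto simp: eventually_at_filter)
    have z0: "filterlim (\<lambda>w. norm (1 - w)) (at_right 0) (at (1::complex) within ball 0 1)"
      using tendsto_norm[OF t0] nz
      by (auto simp: filterlim_at elim!: eventually_mono)
    have "filterlim (\<lambda>w. ln (norm (1 - w))) at_bot (at (1::complex) within ball 0 1)"
      by (rule filterlim_compose[OF ln_at_0 z0])
    hence "filterlim (\<lambda>w. - ln (norm (1 - w))) at_top (at (1::complex) within ball 0 1)"
      by (simp add: filterlim_uminus_at_bot)
    hence "filterlim (\<lambda>w. norm (Ln (1 - w))) at_top (at (1::complex) within ball 0 1)"
    proof (rule filterlim_at_top_mono)
      show "eventually (\<lambda>w. - ln (norm (1 - w)) \<le> norm (Ln (1 - w))) (at (1::complex) within ball 0 1)"
        using nz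
      proof eventually_elim
        case (elim w)
        have "\<bar>Re (Ln (1 - w))\<bar> \<le> norm (Ln (1 - w))" by (rule abs_Re_le_cmod)
        with elim show ?case by simp
      qed
    qed
    hence "filterlim (\<lambda>w. Ln (1 - w)) at_infinity (at (1::complex) within ball 0 1)"
      by (rule filterlim_norm_at_top_imp_at_infinity)
    hence inv0: "((\<lambda>w. inverse (Ln (1 - w))) \<longlongrightarrow> 0) (at (1::complex) within ball 0 1)"
      by (rule filterlim_compose[OF tendsto_inverse_0])
    have "((\<lambda>w. - (w * inverse (Ln (1 - w)))) \<longlongrightarrow> - (1 * 0)) (at (1::complex) within ball 0 1)"
      by (intro tendsto_intros inv0)
    moreover have "eventually (\<lambda>w. - (w * inverse (Ln (1 - w))) = 1 / frakL w)
                     (at (1::complex) within ball 0 1)"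
    proof -
      have "eventually (\<lambda>w. w \<noteq> 0) (at (1::complex) within ball 0 1)"
        by (rule tendsto_imp_eventually_ne[where c = 1]) (auto intro!: tendsto_eq_intros)
      thus ?thesis by eventually_elim (simp add: frakL_def field_simps)
    qed
    ultimately show ?thesis using True by (simp add: tendsto_cong)
  next
    case False
    have re: "Re (1 - z) > 0"
    proof -
      have "Re z \<noteq> 1"
      proof
        assume "Re z = 1"
        with assms have "Im z = 0"
          by (metis abs_Re_le_cmod abs_one antisym cmod_eq_Re power2_eq_1_iff
              cmod_power2 add_cancel_left_right one_power2 zero_eq_power2)
        with \<open>Re z = 1\<close> False show False by (simp add: complex_eq_iff)
      qed
      moreover have "Re z \<le> 1" using assms complex_Re_le_cmod[of z] by linarith
      ultimately show ?thesis by simp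
    qed
    hence slit: "1 - z \<notin> \<real>\<^sub>\<le>\<^sub>0" by (auto simp: complex_nonpos_Reals_iff)
    show ?thesis
    proof (cases "z = 0")
      case True
      define F where "F w = (\<Sum>n. (1 / of_nat (n + 1)) * w ^ n)" for w :: complex
      have F_eq: "F w = frakL w" if "norm w < 1" for w
        using frakL_sums[OF that] by (simp add: F_def sums_iff)
      have "isCont F 0"
        unfolding F_def
      proof (rule isCont_powser)
        show "summable (\<lambda>n. (1 / of_nat (n + 1)) * (1 / 2 :: complex) ^ n)"
          using frakL_sums[of "1/2"] by (simp add: sums_iff)
      qed simp
      hence "(F \<longlongrightarrow> F 0) (at 0 within ball 0 1)"
        unfolding isCont_def by (rule tendsto_within_subset) simp
      moreover have "eventually (\<lambda>w. F w = frakL w) (at 0 within ball 0 1)"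
        by (auto simp: eventually_at_filter F_eq)
      ultimately have "(frakL \<longlongrightarrow> frakL 0) (at 0 within ball 0 1)"
        using F_eq[of 0] by (simp add: tendsto_cong)
      hence "((\<lambda>w. 1 / frakL w) \<longlongrightarrow> 1 / frakL 0) (at 0 within ball 0 1)"
        by (rule tendsto_divide[OF tendsto_const]) (simp add: frakL_def)
      with True show ?thesis by simp
    next
      case nz: False
      have "Ln (1 - z) \<noteq> 0"
        using re nz by (metis Ln_1 exp_Ln exp_zero diff_eq_eq add_cancel_right_right zero_complex.sel(1) less_irrefl)
      hence "((\<lambda>w. 1 / - (Ln (1 - w) / w)) \<longlongrightarrow> 1 / - (Ln (1 - z) / z)) (at z within ball 0 1)"
        using nz slit by (intro tendsto_intros) auto
      moreover have "eventually (\<lambda>w. 1 / - (Ln (1 - w) / w) = 1 / frakL w) (at z within ball 0 1)"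
      proof -
        have "eventually (\<lambda>w. w \<noteq> 0) (at z within ball 0 1)"
          using nz by (intro tendsto_imp_eventually_ne[where c = z]) (auto intro!: tendsto_eq_intros)
        thus ?thesis by eventually_elim (simp add: frakL_def)
      qed
      ultimately show ?thesis using False nz by (simp add: tendsto_cong frakL_def)
    qed
  qed
  show eq: "inv_frakL z = (if z = 1 then 0 else 1 / frakL z)"
    using tendsto_Lim[OF ntriv lim] by (auto simp: inv_frakL_def)
  show "((\<lambda>w. 1 / frakL w) \<longlongrightarrow> inv_frakL z) (at z within ball 0 1)"
    unfolding eq by (rule lim)
qed

definition g_L :: "nat \<Rightarrow> complex \<Rightarrow> complex" where
  "g_L n z = inv_frakL z * (\<Sum>j<n. z ^ j / of_nat (j + 1))"

end

theory Submission
  imports Defs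
begin

text \<open>
  Since \<open>1/L(z) = \<integral>\<^sub>0\<^sup>1 (1 - z)\<^sup>x dx\<close>, the Taylor coefficients of \<open>1/L\<close> are the integrals
  \<open>b\<^sub>n\<close> of \<open>k\<^bsup>-x\<^esup>(n)\<close> over \<open>0 \<le> x \<le> 1\<close>. Hence \<open>b\<^sub>0 = 1\<close>, while \<open>-b\<^sub>n \<ge> 0\<close> is decreasing for
  \<open>n \<ge> 1\<close> and summable. It follows that \<open>g\<^sub>n(z) = 1 - \<Sum>\<^bsub>m\<ge>n\<^esub> r\<^sub>m z\<^sup>m\<close> with \<open>r\<^sub>m\<close> nonnegative and
  decreasing for \<open>m \<ge> n\<close>, of sum \<open>1\<close>, and \<open>r\<^sub>n = 1/(n + 1)\<close>.

  Summation by parts bounds the \<open>A\<^sup>1\<close>-norm \<open>\<Sum> (m + 1) |h(m) - h(m + 1)|\<close> of \<open>g\<^sub>n\<close> by \<open>4\<close>, and the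
  identity \<open>k\<^bsup>1-\<alpha>\<^esup> * k\<^bsup>\<alpha>+1\<^esup> = k\<^sup>2\<close> shows that the \<open>A\<^sup>\<alpha>\<close>-norm is at most the \<open>A\<^sup>1\<close>-norm.

  Only \<open>k\<^bsup>-\<alpha>\<^esup>(0)\<close> is positive, so \<open>|k\<^bsup>-\<alpha>\<^esup>| * k\<^bsup>\<alpha>+1\<^esup> = 2 k\<^bsup>\<alpha>+1\<^esup> - 1\<close> and the \<open>A\<^sup>\<alpha>\<close>-norm of any \<open>h\<close>
  is at most \<open>2 \<Sum> |h(m)| k\<^bsup>\<alpha>+1\<^esup>(m)\<close>. The coefficients \<open>r\<^bsub>m-1\<^esub> - r\<^sub>m\<close> of \<open>(1 - z)(g\<^sub>n(z) - 1)\<close> vanish for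
  \<open>m < n\<close> and are bounded in the weight \<open>m + 1\<close> by the same summation by parts; since
  \<open>k\<^bsup>\<alpha>+1\<^esup>(m)/(m + 1)\<close> tends to \<open>0\<close> for \<open>\<alpha> < 1\<close>, part (ii) follows.
\<close>

lemma cesaro_k_0_right [simp]: "cesaro_k a 0 = 1"
  by (simp add: cesaro_k_def)

lemma cesaro_k_Suc: "cesaro_k a (Suc n) = cesaro_k a n * (a + n) / (Suc n)"
  by (simp add: cesaro_k_def pochhammer_Suc field_simps)

lemma cesaro_k_0_left: "cesaro_k 0 n = (if n = 0 then 1 else 0)"
  by (simp add: cesaro_k_def pochhammer_0_left)

lemma cesaro_k_1_left [simp]: "cesaro_k 1 n = 1"
  by (simp add: cesaro_k_def flip: pochhammer_fact)

lemma cesaro_k_2_left: "cesaro_k 2 n = n + 1"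
  by (induction n) (simp_all add: cesaro_k_Suc field_simps)

lemma cesaro_k_nonneg: "a \<ge> 0 \<Longrightarrow> cesaro_k a n \<ge> 0"
  by (induction n) (simp_all add: cesaro_k_Suc)

lemma cesaro_k_uminus_nonpos:
  assumes "0 \<le> a" "a \<le> 1" "n \<ge> 1"
  shows "cesaro_k (- a) n \<le> 0"
  using \<open>n \<ge> 1\<close>
proof (induction n rule: dec_induct)
  case base
  then show ?case using assms by (simp add: cesaro_k_def)
next
  case (step n)
  then show ?case using assms
    by (simp add: cesaro_k_Suc divide_nonpos_pos mult_nonpos_nonneg)
qed

lemma cesaro_k_Vandermonde: "(\<Sum>i\<le>n. cesaro_k a i * cesaro_k b (n - i)) = cesaro_k (a + b) n"
proof -
  have "(\<Sum>i\<le>n. cesaro_k a i * cesaro_k b (n - i))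
      = (\<Sum>i\<le>n. (n choose i) * pochhammer a i * pochhammer b (n - i) / fact n)"
    by (intro sum.cong refl) (simp add: cesaro_k_def binomial_fact)
  then show ?thesis
    by (simp add: cesaro_k_def pochhammer_binomial_sum sum_divide_distrib)
qed

lemma cesaro_k_ge_1:
  assumes "a \<ge> 0"
  shows "cesaro_k (a + 1) n \<ge> 1"
proof -
  have "cesaro_k a 0 \<le> (\<Sum>i\<le>n. cesaro_k a i)"
    by (rule member_le_sum) (auto simp: cesaro_k_nonneg assms)
  then show ?thesis
    using cesaro_k_Vandermonde[of a 1 n] by simp
qed

lemma cesaro_k_le_1:
  assumes "0 \<le> a" "a \<le> 1"
  shows "cesaro_k a n \<le> 1"
proof -
  have "cesaro_k a n * cesaro_k (1 - a) (n - n) \<le> (\<Sum>i\<le>n. cesaro_k a i * cesaro_k (1 - a) (n - i))"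
    by (rule member_le_sum[where f = "\<lambda>i. cesaro_k a i * cesaro_k (1 - a) (n - i)"])
       (auto simp: cesaro_k_nonneg assms)
  then show ?thesis
    by (simp add: cesaro_k_Vandermonde)
qed

lemma abs_cesaro_k_uminus:
  assumes "0 \<le> a" "a \<le> 1"
  shows "\<bar>cesaro_k (- a) n\<bar> = 2 * cesaro_k 0 n - cesaro_k (- a) n"
  using cesaro_k_uminus_nonpos[OF assms, of n] by (auto simp: cesaro_k_0_left)

lemma conv_abs_cesaro_k_uminus:
  assumes "0 \<le> a" "a \<le> 1"
  shows "(\<Sum>i\<le>n. cesaro_k b i * \<bar>cesaro_k (- a) (n - i)\<bar>) = 2 * cesaro_k b n - cesaro_k (b - a) n"
proof -
  have "(\<Sum>i\<le>n. cesaro_k b i * \<bar>cesaro_k (- a) (n - i)\<bar>)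
     = 2 * (\<Sum>i\<le>n. cesaro_k b i * cesaro_k 0 (n - i)) - (\<Sum>i\<le>n. cesaro_k b i * cesaro_k (- a) (n - i))"
    by (simp add: abs_cesaro_k_uminus[OF assms] algebra_simps sum_subtractf sum_distrib_left sum.distrib)
  then show ?thesis
    by (simp add: cesaro_k_Vandermonde)
qed

lemma abs_cesaro_k_le_2:
  assumes "-1 \<le> a" "a \<le> 1"
  shows "\<bar>cesaro_k a n\<bar> \<le> 2"
proof (cases "a \<ge> 0")
  case True
  then show ?thesis using assms cesaro_k_le_1[of a n] cesaro_k_nonneg[of a n] by simp
next
  case False
  have "\<bar>cesaro_k a (n - 0)\<bar> \<le> (\<Sum>i\<le>n. \<bar>cesaro_k a (n - i)\<bar>)"
    by (rule member_le_sum[where f = "\<lambda>i. \<bar>cesaro_k a (n - i)\<bar>"]) auto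
  also have "\<dots> = 2 - cesaro_k (1 + a) n"
    using conv_abs_cesaro_k_uminus[of "- a" 1 n] False assms by simp
  also have "\<dots> \<le> 2"
    using cesaro_k_nonneg[of "1 + a" n] assms by simp
  finally show ?thesis by simp
qed

lemma cesaro_k_over_Suc_le:
  assumes "0 \<le> a" "a \<le> 1"
  shows "cesaro_k (a + 1) n / (n + 1) \<le> (2 / (n + 2)) powr (1 - a)"
proof (induction n)
  case 0
  then show ?case by simp
next
  case (Suc n)
  have "ln (1 + 1 / (n + 2)) \<le> 1 / (n + 2)"
    by (rule ln_add_one_self_le_self) simp
  then have "(1 - a) * ln (1 + 1 / (n + 2)) \<le> (1 - a) * (1 / (n + 2))"
    using assms by (intro mult_left_mono) auto
  moreover have "ln ((n + 2) / (n + 3)) = - ln (1 + 1 / (n + 2))"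
    by (subst ln_inverse[symmetric]) (auto simp: field_simps)
  ultimately have "- ((1 - a) * (1 / (n + 2))) \<le> (1 - a) * ln ((n + 2) / (n + 3))"
    by (simp only: mult_minus_right neg_le_iff_le)
  then have "1 + (- ((1 - a) * (1 / (n + 2)))) \<le> exp ((1 - a) * ln ((n + 2) / (n + 3)))"
    by (intro order.trans[OF exp_ge_add_one_self]) simp
  then have *: "(a + 1 + n) / (n + 2) \<le> ((n + 2) / (n + 3)) powr (1 - a)"
    by (simp add: powr_def field_simps)
  have "cesaro_k (a + 1) (Suc n) / (Suc n + 1) = cesaro_k (a + 1) n / (n + 1) * ((a + 1 + n) / (n + 2))"
    by (simp add: cesaro_k_Suc field_simps)
  also have "\<dots> \<le> (2 / (n + 2)) powr (1 - a) * ((n + 2) / (n + 3)) powr (1 - a)"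
    using Suc * assms by (intro mult_mono) (auto simp: add_ac)
  also have "\<dots> = (2 / (n + 2) * ((n + 2) / (n + 3))) powr (1 - a)"
    by (subst powr_mult) auto
  also have "\<dots> = (2 / (Suc n + 2)) powr (1 - a)"
    using nonzero_mult_divide_mult_cancel_left[of "real n + 2" 2 "real n + 3"]
    by (simp add: mult.commute add.commute)
  finally show ?case by simp
qed

lemma sums_suminf_shift_conv:
  fixes a b f :: "nat \<Rightarrow> 'a :: {real_normed_field, banach}"
  assumes "summable (\<lambda>l. (\<Sum>i\<le>l. norm (a i) * norm (b (l - i))) * norm (f l))"
  shows "(\<lambda>i. a i * (\<Sum>j. b j * f (i + j))) sums (\<Sum>l. (\<Sum>i\<le>l. a i * b (l - i)) * f l)"
proof -
  define F where "F = (\<lambda>(i, j). a i * b j * f (i + j))"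
  define G where "G = (\<lambda>(l, i). a i * b (l - i) * f l)"
  define S where "S = Sigma UNIV (\<lambda>l::nat. {..l})"
  have bij: "bij_betw (\<lambda>(l, i). (i, l - i)) S (UNIV \<times> UNIV)"
    unfolding S_def by (rule bij_betwI[where g = "\<lambda>(i, j). (i + j, i)"]) auto
  have G_F: "(\<lambda>p. F (case p of (l, i) \<Rightarrow> (i, l - i))) p = G p" if "p \<in> S" for p
    using that by (auto simp: S_def F_def G_def)
  have "(\<Sum>\<^sub>\<infinity>i\<in>{..l}. norm (G (l, i))) = (\<Sum>i\<le>l. norm (a i) * norm (b (l - i))) * norm (f l)" for l
    by (simp add: G_def norm_mult sum_distrib_right)
  moreover have "(\<lambda>l. norm ((\<Sum>i\<le>l. norm (a i) * norm (b (l - i))) * norm (f l))) summable_on UNIV"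
    using assms by (subst summable_on_UNIV_nonneg_real_iff) (auto simp: sum_nonneg abs_mult abs_of_nonneg)
  ultimately have G_abs: "(\<lambda>p. norm (G p)) summable_on S"
    unfolding S_def by (subst Infinite_Sum.abs_summable_on_Sigma_iff) simp
  have "(\<lambda>p. norm (F (case p of (l, i) \<Rightarrow> (i, l - i)))) summable_on S"
    using G_abs by (subst summable_on_cong[OF arg_cong[OF G_F]]) auto
  then have F_abs: "(\<lambda>p. norm (F p)) summable_on (UNIV \<times> UNIV)"
    by (subst (asm) summable_on_reindex_bij_betw[OF bij, of "\<lambda>p. norm (F p)"])
  have F_row: "(\<lambda>j. norm (F (i, j))) summable_on UNIV" for i
    using iffD1[OF Infinite_Sum.abs_summable_on_Sigma_iff F_abs] by simp
  have row: "((\<lambda>j. F (i, j)) has_sum infsum (\<lambda>j. F (i, j)) UNIV) UNIV" for i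
    by (rule has_sum_infsum[OF abs_summable_summable[OF F_row]])
  have inner: "infsum (\<lambda>j. F (i, j)) UNIV = a i * (\<Sum>j. b j * f (i + j))" for i
  proof (cases "a i = 0")
    case False
    have "(\<lambda>j. a i * (b j * f (i + j))) sums (a i * (infsum (\<lambda>j. F (i, j)) UNIV / a i))"
      using has_sum_imp_sums[OF row[of i]] False by (simp add: F_def mult.assoc)
    then have "(\<lambda>j. b j * f (i + j)) sums (infsum (\<lambda>j. F (i, j)) UNIV / a i)"
      unfolding sums_mult_iff[OF False] .
    then show ?thesis
      using False by (simp add: sums_iff)
  qed (simp add: F_def)
  have "(F has_sum infsum F (UNIV \<times> UNIV)) (UNIV \<times> UNIV)"
    by (rule has_sum_infsum[OF abs_summable_summable[OF F_abs]])
  then have "((\<lambda>i. infsum (\<lambda>j. F (i, j)) UNIV) has_sum infsum F (UNIV \<times> UNIV)) UNIV"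
    by (rule has_sum_SigmaD) (rule row)
  then have sums_F: "(\<lambda>i. a i * (\<Sum>j. b j * f (i + j))) sums infsum F (UNIV \<times> UNIV)"
    unfolding inner by (rule has_sum_imp_sums)
  have "infsum F (UNIV \<times> UNIV) = infsum G S"
    unfolding infsum_reindex_bij_betw[OF bij, symmetric] by (rule infsum_cong) (rule G_F)
  moreover have "(G has_sum infsum G S) S"
    by (rule has_sum_infsum[OF abs_summable_summable[OF G_abs]])
  then have "((\<lambda>l. \<Sum>i\<le>l. G (l, i)) has_sum infsum G S) UNIV"
    unfolding S_def by (rule has_sum_SigmaD) (simp add: has_sum_finite)
  then have "(\<lambda>l. (\<Sum>i\<le>l. a i * b (l - i)) * f l) sums infsum G S"
    by (intro has_sum_imp_sums) (simp add: G_def sum_distrib_right)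
  then have "infsum G S = (\<Sum>l. (\<Sum>i\<le>l. a i * b (l - i)) * f l)"
    by (simp add: sums_iff)
  ultimately show ?thesis using sums_F by simp
qed

lemma sum_conv_commute:
  fixes a b :: "nat \<Rightarrow> 'a :: comm_semiring_0"
  shows "(\<Sum>i\<le>n. a i * b (n - i)) = (\<Sum>i\<le>n. b i * a (n - i))"
  using sum.atLeastAtMost_rev[of "\<lambda>i. a i * b (n - i)" 0 n]
  by (simp add: atLeast0AtMost mult.commute)

lemma W_minus_0 [simp]: "W_minus 0 f = f"
proof
  fix n
  have "(\<lambda>i. of_real (cesaro_k 0 i) * f (n + i)) = (\<lambda>i. if i = 0 then f (n + i) else 0)"
    by (auto simp: cesaro_k_0_left)
  moreover have "(\<lambda>i. if i = 0 then f (n + i) else 0) sums f (n + 0)"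
    by (rule sums_single)
  ultimately show "W_minus 0 f n = f n"
    by (simp add: W_minus_def sums_iff)
qed

lemma W_minus_W_minus:
  assumes f: "summable (\<lambda>n. norm (f n))"
    and C: "\<And>l. (\<Sum>i\<le>l. \<bar>cesaro_k a i\<bar> * \<bar>cesaro_k b (l - i)\<bar>) \<le> C"
  shows "W_minus a (W_minus b f) = W_minus (a + b) f"
proof
  fix n
  have fn: "summable (\<lambda>l. C * norm (f (n + l)))"
    using summable_ignore_initial_segment[OF f, of n] by (intro summable_mult) (simp add: add.commute)
  have "summable (\<lambda>l. (\<Sum>i\<le>l. \<bar>cesaro_k a i\<bar> * \<bar>cesaro_k b (l - i)\<bar>) * norm (f (n + l)))"
    by (rule summable_comparison_test'[OF fn, of 0])
       (auto simp: abs_mult sum_nonneg intro!: mult_right_mono C)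
  then have "(\<lambda>i. of_real (cesaro_k a i) * (\<Sum>j. of_real (cesaro_k b j) * f (n + (i + j))))
    sums (\<Sum>l. (\<Sum>i\<le>l. of_real (cesaro_k a i) * of_real (cesaro_k b (l - i))) * f (n + l))"
    by (intro sums_suminf_shift_conv[where f = "\<lambda>l. f (n + l)"]) simp
  also have "(\<lambda>l. \<Sum>i\<le>l. of_real (cesaro_k a i) * of_real (cesaro_k b (l - i)) :: complex)
    = (\<lambda>l. of_real (cesaro_k (a + b) l))"
    by (simp flip: cesaro_k_Vandermonde)
  finally show "W_minus a (W_minus b f) n = W_minus (a + b) f n"
    by (simp add: W_minus_def sums_iff add.assoc)
qed

lemma conv_abs_cesaro_k_uminus_le_2:
  assumes "0 \<le> a" "a \<le> 1"
  shows "(\<Sum>i\<le>l. \<bar>cesaro_k a i\<bar> * \<bar>cesaro_k (- a) (l - i)\<bar>) \<le> 2"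
  using conv_abs_cesaro_k_uminus[OF assms, of a l] cesaro_k_le_1[OF assms, of l] cesaro_k_nonneg[of a] assms
  by (simp add: cesaro_k_0_left split: if_splits)

lemma W_minus_inverse:
  assumes "summable (\<lambda>n. norm (f n))" "0 \<le> a" "a \<le> 1"
  shows "W_minus a (W_minus (- a) f) = f" "W_minus (- a) (W_minus a f) = f"
proof -
  note le_2 = conv_abs_cesaro_k_uminus_le_2[OF assms(2,3)]
  show "W_minus a (W_minus (- a) f) = f"
    using W_minus_W_minus[OF assms(1) le_2] by simp
  have "(\<Sum>i\<le>l. \<bar>cesaro_k (- a) i\<bar> * \<bar>cesaro_k a (l - i)\<bar>) \<le> 2" for l
    using le_2[of l] by (subst sum_conv_commute)
  from W_minus_W_minus[OF assms(1) this] show "W_minus (- a) (W_minus a f) = f"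
    by simp
qed

lemma summable_W_minus_weighted:
  fixes f :: "nat \<Rightarrow> complex"
  defines "S \<equiv> \<lambda>b c l. \<Sum>i\<le>l. cesaro_k c i * \<bar>cesaro_k b (l - i)\<bar>"
  assumes "- 1 \<le> b" "b \<le> 1" "0 \<le> c"
    and f: "summable (\<lambda>n. norm (f n))" and Sf: "summable (\<lambda>l. S b c l * norm (f l))"
  shows "summable (\<lambda>n. norm (W_minus b f n) * cesaro_k c n)"
    and "(\<Sum>n. norm (W_minus b f n) * cesaro_k c n) \<le> (\<Sum>l. S b c l * norm (f l))"
proof -
  have "norm (W_minus b f n) \<le> (\<Sum>j. \<bar>cesaro_k b j\<bar> * norm (f (n + j)))" for n
  proof -
    have fn: "summable (\<lambda>j. 2 * norm (f (n + j)))"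
      using summable_ignore_initial_segment[OF f, of n] by (intro summable_mult) (simp add: add.commute)
    have "summable (\<lambda>j. norm (of_real (cesaro_k b j) * f (n + j)))"
      by (rule summable_comparison_test'[OF fn, of 0])
         (use assms in \<open>auto simp: norm_mult intro!: mult_right_mono abs_cesaro_k_le_2\<close>)
    from summable_norm[OF this] show ?thesis
      by (simp add: W_minus_def norm_mult)
  qed
  then have le: "norm (W_minus b f n) * cesaro_k c n
      \<le> cesaro_k c n * (\<Sum>j. \<bar>cesaro_k b j\<bar> * norm (f (n + j)))" for n
    using cesaro_k_nonneg[OF \<open>0 \<le> c\<close>, of n] by (simp add: mult.commute mult_left_mono)
  have *: "(\<lambda>n. cesaro_k c n * (\<Sum>j. \<bar>cesaro_k b j\<bar> * norm (f (n + j)))) sums (\<Sum>l. S b c l * norm (f l))"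
    using Sf cesaro_k_nonneg[OF \<open>0 \<le> c\<close>] unfolding S_def
    by (intro sums_suminf_shift_conv[where f = "\<lambda>l. norm (f l)"]) simp
  show sm: "summable (\<lambda>n. norm (W_minus b f n) * cesaro_k c n)"
    by (rule summable_comparison_test'[OF sums_summable[OF *], of 0])
       (use le cesaro_k_nonneg[OF \<open>0 \<le> c\<close>] in auto)
  show "(\<Sum>n. norm (W_minus b f n) * cesaro_k c n) \<le> (\<Sum>l. S b c l * norm (f l))"
    using suminf_le[OF le sm sums_summable[OF *]] * by (simp add: sums_iff)
qed

lemma summable_norm_if_cesaro_weighted:
  assumes "summable (\<lambda>n. norm (u n) * cesaro_k (a + 1) n)" "0 \<le> a"
  shows "summable (\<lambda>n. norm (u n))"
  by (rule summable_comparison_test'[OF assms(1), of 0])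
     (use cesaro_k_ge_1[OF assms(2)] in \<open>simp add: mult_le_cancel_left1\<close>)

lemma W_plus_eq:
  assumes "is_W_deriv a h u" "0 \<le> a" "a \<le> 1"
  shows "W_plus a h = u"
  unfolding W_plus_def
proof (rule the_equality)
  fix u' assume "is_W_deriv a h u'"
  then show "u' = u"
    using assms W_minus_inverse(2)[OF summable_norm_if_cesaro_weighted]
    unfolding is_W_deriv_def by metis
qed fact

lemma has_l1_coeffs_unique:
  assumes "has_l1_coeffs f h" "has_l1_coeffs f h'"
  shows "h = h'"
proof -
  define d where "d n = h n - h' n" for n
  have sums0: "(\<lambda>n. d n * z ^ n) sums 0" if "norm z \<le> 1" for z
    using assms that sums_diff[of "\<lambda>n. h n * z ^ n" "f z" "\<lambda>n. h' n * z ^ n" "f z"]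
    by (auto simp: has_l1_coeffs_def d_def algebra_simps)
  have "d n = 0" for n
  proof (induction n rule: less_induct)
    case (less n)
    have shift: "(\<lambda>k. d (n + k) * z ^ k) sums 0" if "norm z < 1" "z \<noteq> 0" for z
    proof -
      have "(\<lambda>k. d (k + n) * z ^ (k + n)) sums (0 - (\<Sum>i<n. d i * z ^ i))"
        using sums0[of z] that by (intro sums_split_initial_segment) auto
      then have "(\<lambda>k. z ^ n * (d (n + k) * z ^ k)) sums (z ^ n * 0)"
        using less by (simp add: power_add mult_ac add.commute)
      then show ?thesis
        using that by (subst (asm) sums_mult_iff) auto
    qed
    have "((\<lambda>z::complex. 0) \<longlongrightarrow> d (n + 0)) (at 0)"
      using shift by (intro powser_limit_0_strong[of 1 "\<lambda>k. d (n + k)"]) auto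
    then show "d n = 0"
      by (simp add: tendsto_const_iff)
  qed
  then show ?thesis
    by (auto simp: d_def)
qed

lemma A_spaceI:
  assumes "has_l1_coeffs f h" "is_W_deriv a h u" "0 \<le> a" "a \<le> 1"
  shows "f \<in> A_space a" "A_norm a f = (\<Sum>n. norm (u n) * cesaro_k (a + 1) n)"
    "0 \<le> A_norm a f"
proof -
  show "f \<in> A_space a"
    using assms by (auto simp: A_space_def)
  have "l1_coeffs f = h"
    unfolding l1_coeffs_def using assms has_l1_coeffs_unique by blast
  then show *: "A_norm a f = (\<Sum>n. norm (u n) * cesaro_k (a + 1) n)"
    using W_plus_eq[OF assms(2-4)] by (simp add: A_norm_def)
  show "0 \<le> A_norm a f"
    unfolding * using assms cesaro_k_nonneg[of "a + 1"]
    by (intro suminf_nonneg) (auto simp: is_W_deriv_def)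
qed

lemma A_space_if_first_difference_summable:
  assumes f: "has_l1_coeffs f h" and a: "0 \<le> a" "a \<le> 1"
    and v: "summable (\<lambda>n. norm (h n - h (Suc n)) * (n + 1))"
  shows "f \<in> A_space a" "A_norm a f \<le> (\<Sum>n. norm (h n - h (Suc n)) * (n + 1))"
proof -
  define v where "v n = h n - h (Suc n)" for n
  have h0: "h \<longlonglongrightarrow> 0"
    using f summable_LIMSEQ_zero tendsto_norm_zero_iff unfolding has_l1_coeffs_def by blast
  have v2: "summable (\<lambda>n. norm (v n) * cesaro_k (1 + 1) n)"
    using assms by (simp add: v_def cesaro_k_2_left)
  have v1: "summable (\<lambda>n. norm (v n))"
    by (rule summable_norm_if_cesaro_weighted[OF v2]) simp
  have "W_minus 1 v n = h n" for n
  proof -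
    have "(\<lambda>k. h (n + k)) \<longlonglongrightarrow> 0"
      using LIMSEQ_ignore_initial_segment[OF h0, of n] by (simp add: add.commute)
    from telescope_sums'[OF this] show ?thesis
      by (simp add: W_minus_def v_def sums_iff)
  qed
  then have h: "h = W_minus 1 v"
    by auto
  have conv: "(\<Sum>i\<le>l. cesaro_k c i * \<bar>cesaro_k (1 - a) (l - i)\<bar>) = cesaro_k (1 - a + c) l" for c l
    using cesaro_k_nonneg[of "1 - a"] a by (simp add: cesaro_k_Vandermonde add.commute)
  have "W_minus a (W_minus (1 - a) v) = W_minus (a + (1 - a)) v"
    using v1
  proof (rule W_minus_W_minus)
    show "(\<Sum>i\<le>l. \<bar>cesaro_k a i\<bar> * \<bar>cesaro_k (1 - a) (l - i)\<bar>) \<le> 1" for l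
      using conv[of a l] cesaro_k_nonneg[OF a(1)] by simp
  qed
  moreover
  have sm: "summable (\<lambda>l. (\<Sum>i\<le>l. cesaro_k (a + 1) i * \<bar>cesaro_k (1 - a) (l - i)\<bar>) * norm (v l))"
    using v2 unfolding conv by (simp add: mult.commute)
  note * = summable_W_minus_weighted[OF _ _ _ v1 sm]
  ultimately have d: "is_W_deriv a h (W_minus (1 - a) v)"
    unfolding is_W_deriv_def h using a * by simp
  show "f \<in> A_space a"
    using A_spaceI(1)[OF f d a] .
  show "A_norm a f \<le> (\<Sum>n. norm (h n - h (Suc n)) * (n + 1))"
    unfolding A_spaceI(2)[OF f d a] using *(2) a unfolding conv
    by (simp add: cesaro_k_2_left mult.commute flip: v_def)
qed

lemma A_space_if_weighted_coeffs_summable: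
  assumes f: "has_l1_coeffs f h" and a: "0 \<le> a" "a \<le> 1"
    and sm: "summable (\<lambda>n. norm (h n) * cesaro_k (a + 1) n)"
  shows "f \<in> A_space a" "0 \<le> A_norm a f" "A_norm a f \<le> 2 * (\<Sum>n. norm (h n) * cesaro_k (a + 1) n)"
proof -
  have h1: "summable (\<lambda>n. norm (h n))"
    using f by (simp add: has_l1_coeffs_def)
  have S: "(\<Sum>i\<le>l. cesaro_k (a + 1) i * \<bar>cesaro_k (- a) (l - i)\<bar>) = 2 * cesaro_k (a + 1) l - 1" for l
    by (simp add: conv_abs_cesaro_k_uminus[OF a])
  have "(\<lambda>l. (2 * cesaro_k (a + 1) l - 1) * norm (h l)) =
      (\<lambda>l. 2 * (norm (h l) * cesaro_k (a + 1) l) - norm (h l))"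
    by (auto simp: algebra_simps)
  then have sm': "summable (\<lambda>l. (\<Sum>i\<le>l. cesaro_k (a + 1) i * \<bar>cesaro_k (- a) (l - i)\<bar>) * norm (h l))"
    unfolding S using sm h1 by (simp add: summable_diff summable_mult)
  note * = summable_W_minus_weighted[OF _ _ _ h1 sm']
  have d: "is_W_deriv a h (W_minus (- a) h)"
    unfolding is_W_deriv_def using a * W_minus_inverse(1)[OF h1 a] by simp
  show "f \<in> A_space a" "0 \<le> A_norm a f"
    using A_spaceI(1,3)[OF f d a] by auto
  have "A_norm a f \<le> (\<Sum>l. (\<Sum>i\<le>l. cesaro_k (a + 1) i * \<bar>cesaro_k (- a) (l - i)\<bar>) * norm (h l))"
    unfolding A_spaceI(2)[OF f d a] using *(2) a by simp
  also have "\<dots> \<le> (\<Sum>l. 2 * (norm (h l) * cesaro_k (a + 1) l))"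
    using sm' unfolding S by (intro suminf_le summable_mult sm) (auto simp: algebra_simps)
  finally show "A_norm a f \<le> 2 * (\<Sum>n. norm (h n) * cesaro_k (a + 1) n)"
    using sm by (simp add: suminf_mult)
qed

definition inv_log_coeff :: "nat \<Rightarrow> real" where
  "inv_log_coeff n = integral {0..1} (\<lambda>x. cesaro_k (- x) n)"

lemma continuous_on_cesaro_k: "continuous_on A (\<lambda>x. cesaro_k (- x) n)"
  unfolding cesaro_k_def pochhammer_prod by (intro continuous_intros) auto

lemma integrable_cesaro_k: "(\<lambda>x. cesaro_k (- x) n) integrable_on {0..1}"
  by (intro integrable_continuous_real continuous_on_cesaro_k)

lemma inv_log_coeff_0 [simp]: "inv_log_coeff 0 = 1"
  by (simp add: inv_log_coeff_def)

lemma inv_log_coeff_nonpos: "n \<ge> 1 \<Longrightarrow> inv_log_coeff n \<le> 0"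
  using integral_le[OF integrable_cesaro_k[of n] integrable_0] cesaro_k_uminus_nonpos[of _ n]
  by (simp add: inv_log_coeff_def)

lemma inv_log_coeff_le_Suc:
  assumes "n \<ge> 1"
  shows "inv_log_coeff n \<le> inv_log_coeff (Suc n)"
  unfolding inv_log_coeff_def
proof (intro integral_le integrable_cesaro_k)
  fix x :: real assume x: "x \<in> {0..1}"
  have "(- x + n) / Suc n \<le> 1"
    using x by (simp add: field_simps)
  then have "cesaro_k (- x) n * 1 \<le> cesaro_k (- x) n * ((- x + n) / Suc n)"
    using x assms by (intro mult_left_mono_neg cesaro_k_uminus_nonpos) auto
  then show "cesaro_k (- x) n \<le> cesaro_k (- x) (Suc n)"
    by (simp add: cesaro_k_Suc)
qed

lemma sum_inv_log_coeff_nonneg: "(\<Sum>i\<le>n. inv_log_coeff i) \<ge> 0"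
proof -
  have "(\<Sum>i\<le>n. inv_log_coeff i) = integral {0..1} (\<lambda>x. \<Sum>i\<le>n. cesaro_k (- x) i)"
    unfolding inv_log_coeff_def by (intro integral_sum[symmetric]) (auto simp: integrable_cesaro_k)
  also have "(\<lambda>x. \<Sum>i\<le>n. cesaro_k (- x) i) = (\<lambda>x. cesaro_k (1 - x) n)"
    using cesaro_k_Vandermonde[of _ 1 n] by simp
  also have "integral {0..1} (\<lambda>x. cesaro_k (1 - x) n) \<ge> 0"
    by (intro Henstock_Kurzweil_Integration.integral_nonneg integrable_continuous_real)
       (auto simp: cesaro_k_nonneg cesaro_k_def pochhammer_prod prod_nonneg intro!: continuous_intros)
  finally show ?thesis .
qed

lemma summable_inv_log_coeff: "summable (\<lambda>n. \<bar>inv_log_coeff n\<bar>)"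
proof (rule summableI_nonneg_bounded)
  fix n
  have "(\<Sum>i\<le>n. \<bar>inv_log_coeff i\<bar>) = (\<Sum>i\<le>n. (if i = 0 then 2 else 0) - inv_log_coeff i)"
    by (intro sum.cong refl) (use inv_log_coeff_nonpos in \<open>auto simp: abs_of_nonpos\<close>)
  also have "\<dots> \<le> 2"
    using sum_inv_log_coeff_nonneg[of n] by (simp add: sum_subtractf)
  finally show "(\<Sum>i<n. \<bar>inv_log_coeff i\<bar>) \<le> 2"
    using sum_mono2[of "{..n}" "{..<n}" "\<lambda>i. \<bar>inv_log_coeff i\<bar>"] by force
qed simp

lemma DERIV_cesaro_k_at_0:
  "((\<lambda>t. cesaro_k (- t) (Suc n)) has_real_derivative - 1 / Suc n) (at 0)"
  unfolding CARAT_DERIV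
proof (intro exI conjI allI)
  let ?g = "\<lambda>t::real. - pochhammer (- t + 1) n / fact (Suc n)"
  show "cesaro_k (- t) (Suc n) - cesaro_k (- 0) (Suc n) = ?g t * (t - 0)" for t
    by (simp add: cesaro_k_def pochhammer_rec)
  show "isCont ?g 0"
    unfolding pochhammer_prod by (intro continuous_intros) auto
  show "?g 0 = - 1 / Suc n"
    by (simp flip: pochhammer_fact)
qed

text \<open>Compares the coefficients of \<open>z\<^bsup>n+1\<^esup>\<close> in
  \<open>d/dx (1 - z)\<^sup>x = (1 - z)\<^sup>x log (1 - z)\<close>.\<close>

lemma DERIV_cesaro_k:
  "((\<lambda>x. cesaro_k (- x) (Suc n)) has_real_derivative - (\<Sum>j\<le>n. cesaro_k (- x) (n - j) / (j + 1))) (at x)"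
proof -
  have "(\<lambda>t. cesaro_k (- (t + x)) (Suc n))
      = (\<lambda>t. cesaro_k (- x) (Suc n) + (\<Sum>j\<le>n. cesaro_k (- t) (Suc j) * cesaro_k (- x) (n - j)))"
  proof
    fix t
    have "cesaro_k (- (t + x)) (Suc n) = (\<Sum>i\<le>Suc n. cesaro_k (- t) i * cesaro_k (- x) (Suc n - i))"
      by (simp only: cesaro_k_Vandermonde) simp
    then show "cesaro_k (- (t + x)) (Suc n)
        = cesaro_k (- x) (Suc n) + (\<Sum>j\<le>n. cesaro_k (- t) (Suc j) * cesaro_k (- x) (n - j))"
      by (subst (asm) sum.atMost_Suc_shift) simp
  qed
  moreover have "((\<lambda>t. cesaro_k (- x) (Suc n) + (\<Sum>j\<le>n. cesaro_k (- t) (Suc j) * cesaro_k (- x) (n - j)))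
    has_real_derivative 0 + (\<Sum>j\<le>n. - 1 / Suc j * cesaro_k (- x) (n - j))) (at 0)"
    by (intro DERIV_add DERIV_const DERIV_sum DERIV_cmult_right DERIV_cesaro_k_at_0)
  moreover have "0 + (\<Sum>j\<le>n. - 1 / Suc j * cesaro_k (- x) (n - j)) = - (\<Sum>j\<le>n. cesaro_k (- x) (n - j) / (j + 1))"
    by (simp add: sum_negf[symmetric] add.commute)
  ultimately show ?thesis
    using DERIV_shift[of "\<lambda>x. cesaro_k (- x) (Suc n)" _ 0 x] by simp
qed

lemma inv_log_coeff_conv:
  "(\<Sum>j\<le>n. inv_log_coeff (n - j) / (j + 1)) = (if n = 0 then 1 else 0)"
proof -
  have "((\<lambda>x. - (\<Sum>j\<le>n. cesaro_k (- x) (n - j) / (j + 1))) has_integral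
      cesaro_k (- 1) (Suc n) - cesaro_k (- 0) (Suc n)) {0..1}"
    using has_field_derivative_at_within[OF DERIV_cesaro_k]
    by (intro fundamental_theorem_of_calculus)
       (simp_all flip: has_real_derivative_iff_has_vector_derivative)
  moreover have "((\<lambda>x. - (\<Sum>j\<le>n. cesaro_k (- x) (n - j) / (j + 1))) has_integral
      - (\<Sum>j\<le>n. inv_log_coeff (n - j) / (j + 1))) {0..1}"
    unfolding inv_log_coeff_def
    by (intro has_integral_neg has_integral_sum has_integral_divide integrable_integral integrable_cesaro_k) auto
  ultimately have "- (\<Sum>j\<le>n. inv_log_coeff (n - j) / (j + 1)) = cesaro_k (- 1) (Suc n) - cesaro_k (- 0) (Suc n)"
    by (rule has_integral_unique[rotated])
  also have "cesaro_k (- 1) (Suc n) = (if n = 0 then - 1 else 0)"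
    by (simp add: cesaro_k_def pochhammer_rec pochhammer_0_left)
  finally show ?thesis
    by (simp add: cesaro_k_0_left split: if_splits)
qed

lemma has_l1_coeffs_inv_frakL: "has_l1_coeffs inv_frakL (\<lambda>n. of_real (inv_log_coeff n))"
proof -
  define b :: "nat \<Rightarrow> complex" where "b n = of_real (inv_log_coeff n)" for n
  define B where "B z = (\<Sum>n. b n * z ^ n)" for z
  have sm: "summable (\<lambda>n. norm (b n))"
    using summable_inv_log_coeff by (simp add: b_def)
  have le: "norm (b n * z ^ n) \<le> norm (b n)" if "z \<in> cball 0 1" for n z
    using that by (auto simp: norm_mult norm_power intro!: mult_left_le power_le_one)
  have smz: "summable (\<lambda>n. norm (b n * z ^ n))" if "z \<in> cball 0 1" for z
    by (rule summable_comparison_test'[OF sm, of 0]) (use le that in auto)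
  have sums_B: "(\<lambda>n. b n * z ^ n) sums B z" if "z \<in> cball 0 1" for z
    unfolding B_def using summable_norm_cancel[OF smz[OF that]] by (rule summable_sums)
  have inside: "B z = 1 / frakL z" if "norm z < 1" for z
  proof -
    have L: "summable (\<lambda>j. norm (z ^ j / of_nat (j + 1)))"
      by (rule summable_comparison_test'[OF summable_geometric[of "norm z"], of 0])
         (use that in \<open>auto simp: norm_divide norm_power divide_le_eq mult_le_cancel_left1 simp del: of_nat_Suc\<close>)
    have "(\<lambda>k. \<Sum>i\<le>k. z ^ i / of_nat (i + 1) * (b (k - i) * z ^ (k - i))) sums
      ((\<Sum>j. z ^ j / of_nat (j + 1)) * (\<Sum>n. b n * z ^ n))"
      by (rule Cauchy_product_sums[OF L smz]) (use that in auto)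
    also have "(\<lambda>k. \<Sum>i\<le>k. z ^ i / of_nat (i + 1) * (b (k - i) * z ^ (k - i))) =
      (\<lambda>k. of_real (\<Sum>i\<le>k. inv_log_coeff (k - i) / (i + 1)) * z ^ k)"
      by (auto simp: b_def sum_distrib_right power_add[symmetric] intro!: sum.cong)
    also have "\<dots> = (\<lambda>k. if k = 0 then 1 else 0)"
      unfolding inv_log_coeff_conv by auto
    finally have "(\<Sum>j. z ^ j / of_nat (j + 1)) * (\<Sum>n. b n * z ^ n) = 1"
      using sums_unique2[OF _ sums_single[of 0 "\<lambda>_. 1"]] by blast
    then show ?thesis
      using frakL_sums[OF that]
      by (metis B_def mult.commute nonzero_divide_eq_eq mult_zero_left sums_unique zero_neq_one)
  qed
  have "uniform_limit (cball 0 1) (\<lambda>n z. \<Sum>i<n. b i * z ^ i) B sequentially"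
    unfolding B_def by (rule Weierstrass_m_test[OF le sm])
  then have cont: "continuous_on (cball 0 1) B"
    by (rule uniform_limit_theorem[rotated]) (auto intro!: always_eventually continuous_intros)
  have "B z = inv_frakL z" if z: "z \<in> cball 0 1" for z
  proof -
    have "(B \<longlongrightarrow> B z) (at z within ball 0 1)"
      using cont z ball_subset_cball tendsto_within_subset unfolding continuous_on_def by blast
    moreover have "eventually (\<lambda>w. B w = 1 / frakL w) (at z within ball 0 1)"
      by (auto simp: eventually_at_filter inside)
    ultimately have "((\<lambda>w. 1 / frakL w) \<longlongrightarrow> B z) (at z within ball 0 1)"
      by (simp add: tendsto_cong)
    moreover have "at z within ball 0 1 \<noteq> bot"
      using z islimpt_ball[of z "0::complex" 1] by (simp add: trivial_limit_within)
    ultimately show ?thesis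
      using inv_frakL_closed_disc(2)[of z] z tendsto_unique by force
  qed
  then show ?thesis
    using sm sums_B unfolding has_l1_coeffs_def b_def by auto
qed

lemma has_l1_coeffs_add:
  assumes "has_l1_coeffs f a" "has_l1_coeffs g b"
  shows "has_l1_coeffs (\<lambda>z. f z + g z) (\<lambda>n. a n + b n)"
  unfolding has_l1_coeffs_def
proof (intro conjI ballI)
  have "summable (\<lambda>n. norm (a n) + norm (b n))"
    using assms by (intro summable_add) (auto simp: has_l1_coeffs_def)
  then show "summable (\<lambda>n. norm (a n + b n))"
    by (rule summable_comparison_test'[of _ 0]) (auto simp: norm_triangle_ineq)
  show "(\<lambda>n. (a n + b n) * z ^ n) sums (f z + g z)" if "z \<in> cball 0 1" for z
    using assms that unfolding has_l1_coeffs_def distrib_right by (intro sums_add) auto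
qed

lemma has_l1_coeffs_mult:
  assumes f: "has_l1_coeffs f a" and g: "has_l1_coeffs g b"
  shows "has_l1_coeffs (\<lambda>z. f z * g z) (\<lambda>n. \<Sum>i\<le>n. a i * b (n - i))"
  unfolding has_l1_coeffs_def
proof (intro conjI ballI)
  have sm: "summable (\<lambda>n. norm (a n))" "summable (\<lambda>n. norm (b n))"
    using assms by (auto simp: has_l1_coeffs_def)
  then have "summable (\<lambda>n. \<Sum>i\<le>n. norm (a i) * norm (b (n - i)))"
    by (intro summable_Cauchy_product) auto
  then show "summable (\<lambda>n. norm (\<Sum>i\<le>n. a i * b (n - i)))"
    by (rule summable_comparison_test'[of _ 0]) (auto simp flip: norm_mult intro!: norm_sum)
  fix z :: complex assume z: "z \<in> cball 0 1"
  have "norm (c n * z ^ n) \<le> norm (c n)" for c :: "nat \<Rightarrow> complex" and n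
    using z by (auto simp: norm_mult norm_power intro!: mult_left_le power_le_one)
  then have "summable (\<lambda>n. norm (a n * z ^ n))" "summable (\<lambda>n. norm (b n * z ^ n))"
    by (auto intro: summable_comparison_test'[OF sm(1), of 0] summable_comparison_test'[OF sm(2), of 0])
  then have "(\<lambda>n. \<Sum>i\<le>n. a i * z ^ i * (b (n - i) * z ^ (n - i))) sums
      ((\<Sum>n. a n * z ^ n) * (\<Sum>n. b n * z ^ n))"
    by (rule Cauchy_product_sums)
  moreover have "(\<Sum>i\<le>n. a i * z ^ i * (b (n - i) * z ^ (n - i))) = (\<Sum>i\<le>n. a i * b (n - i)) * z ^ n" for n
    by (auto simp: sum_distrib_right power_add[symmetric] intro!: sum.cong)
  moreover have "(\<Sum>n. a n * z ^ n) = f z" "(\<Sum>n. b n * z ^ n) = g z"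
    using f g z by (auto simp: has_l1_coeffs_def sums_iff)
  ultimately show "(\<lambda>n. (\<Sum>i\<le>n. a i * b (n - i)) * z ^ n) sums (f z * g z)"
    by simp
qed

lemma has_l1_coeffs_polynomial:
  assumes "\<And>z. f z = (\<Sum>j<n. a j * z ^ j)" "\<And>j. j \<ge> n \<Longrightarrow> a j = 0"
  shows "has_l1_coeffs f a"
  unfolding has_l1_coeffs_def assms(1)
proof (intro conjI ballI)
  show "summable (\<lambda>j. norm (a j))"
    by (rule summable_finite[of "{..<n}"]) (simp_all add: assms(2))
  show "(\<lambda>j. a j * z ^ j) sums (\<Sum>j<n. a j * z ^ j)" for z
    by (rule sums_finite) (simp_all add: assms(2))
qed

definition remainder_coeff :: "nat \<Rightarrow> nat \<Rightarrow> real" where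
  "remainder_coeff n m = (if m < n then 0 else \<Sum>j<n. - inv_log_coeff (m - j) / (j + 1))"

lemma remainder_coeff_nonneg: "remainder_coeff n m \<ge> 0"
  unfolding remainder_coeff_def
  by (auto intro!: sum_nonneg divide_nonpos_nonneg inv_log_coeff_nonpos)

lemma remainder_coeff_Suc_le: "m \<ge> n \<Longrightarrow> remainder_coeff n (Suc m) \<le> remainder_coeff n m"
  using inv_log_coeff_le_Suc unfolding remainder_coeff_def
  by (auto intro!: sum_mono divide_right_mono simp: Suc_diff_le)

lemma remainder_coeff_same:
  assumes "n \<ge> 1"
  shows "remainder_coeff n n = 1 / (n + 1)"
proof -
  have "(\<Sum>j\<le>n. inv_log_coeff (n - j) / (j + 1)) = 0"
    using assms by (subst inv_log_coeff_conv) simp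
  then show ?thesis
    by (simp add: remainder_coeff_def sum_negf lessThan_Suc_atMost[symmetric] add.commute)
qed

lemma has_l1_coeffs_g_L:
  assumes "n \<ge> 1"
  shows "has_l1_coeffs (g_L n) (\<lambda>m. of_real ((if m = 0 then 1 else 0) - remainder_coeff n m))"
proof -
  define s :: "nat \<Rightarrow> real" where "s j = (if j < n then 1 / (j + 1) else 0)" for j
  have "has_l1_coeffs (\<lambda>z. \<Sum>j<n. z ^ j / of_nat (j + 1)) (\<lambda>j. of_real (s j))"
    by (rule has_l1_coeffs_polynomial[where n = n]) (auto simp: s_def field_simps intro!: sum.cong)
  from has_l1_coeffs_mult[OF this has_l1_coeffs_inv_frakL]
  have "has_l1_coeffs (g_L n) (\<lambda>m. of_real (\<Sum>i\<le>m. s i * inv_log_coeff (m - i)))"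
    by (simp add: g_L_def[abs_def] mult.commute)
  moreover have "(\<Sum>i\<le>m. s i * inv_log_coeff (m - i)) = (if m = 0 then 1 else 0) - remainder_coeff n m" for m
  proof (cases "m < n")
    case True
    then have "(\<Sum>i\<le>m. s i * inv_log_coeff (m - i)) = (\<Sum>i\<le>m. inv_log_coeff (m - i) / (i + 1))"
      by (intro sum.cong) (auto simp: s_def)
    with True show ?thesis
      unfolding inv_log_coeff_conv by (simp add: remainder_coeff_def)
  next
    case False
    have "(\<Sum>i\<le>m. s i * inv_log_coeff (m - i)) = (\<Sum>i<n. s i * inv_log_coeff (m - i))"
      using False by (intro sum.mono_neutral_right) (auto simp: s_def)
    also have "\<dots> = - remainder_coeff n m"
      using False by (simp add: remainder_coeff_def s_def sum_negf add.commute)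
    finally show ?thesis
      using False assms by simp
  qed
  ultimately show ?thesis
    by simp
qed

lemma remainder_coeff_sums:
  assumes "n \<ge> 1" "norm z \<le> 1"
  shows "(\<lambda>m. of_real (remainder_coeff n m) * z ^ m) sums (1 - g_L n z)"
proof -
  have "(\<lambda>m. of_real ((if m = 0 then 1 else 0) - remainder_coeff n m) * z ^ m) sums g_L n z"
    using has_l1_coeffs_g_L[OF assms(1)] assms(2) by (auto simp: has_l1_coeffs_def)
  from sums_diff[OF sums_single[of 0 "\<lambda>_. 1"] this] show ?thesis
    by (rule sums_cong[THEN iffD1, rotated]) (auto simp: algebra_simps)
qed

lemma remainder_coeff_sums_1:
  assumes "n \<ge> 1"
  shows "remainder_coeff n sums 1"
proof -
  have "(\<lambda>m. of_real (remainder_coeff n m) :: complex) sums of_real 1"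
    using remainder_coeff_sums[OF assms, of 1] inv_frakL_closed_disc(1)[of 1] by (simp add: g_L_def)
  then show ?thesis
    by (simp only: sums_of_real_iff)
qed

lemma remainder_coeff_sum_differences:
  assumes "n \<ge> 1"
  shows "(\<Sum>m<n+k. \<bar>remainder_coeff n m - remainder_coeff n (Suc m)\<bar> * (m + 1))
      + (n + k) * remainder_coeff n (n + k)
    = 2 * n * remainder_coeff n n + (\<Sum>i<k. remainder_coeff n (n + i))"
proof (induction k)
  case 0
  obtain p where p: "n = Suc p"
    using assms by (cases n) auto
  have "(\<Sum>m<p. \<bar>remainder_coeff n m - remainder_coeff n (Suc m)\<bar> * (m + 1)) = 0"
    by (intro sum.neutral) (simp add: remainder_coeff_def p)
  moreover have "remainder_coeff n p = 0"
    by (simp add: remainder_coeff_def p)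
  ultimately show ?case
    using remainder_coeff_nonneg[of n n] p by (simp add: algebra_simps)
next
  case (Suc k)
  have "\<bar>remainder_coeff n (n + k) - remainder_coeff n (Suc (n + k))\<bar>
      = remainder_coeff n (n + k) - remainder_coeff n (Suc (n + k))"
    using remainder_coeff_Suc_le[of n "n + k"] by simp
  with Suc show ?case
    by (simp add: algebra_simps)
qed

lemma remainder_coeff_differences:
  assumes "n \<ge> 1"
  defines "w \<equiv> \<lambda>m. \<bar>remainder_coeff n m - remainder_coeff n (Suc m)\<bar> * (real m + 1)"
  shows "summable w" "suminf w \<le> 3"
proof -
  have le: "sum w {..<N} \<le> 3" for N
  proof -
    have "sum w {..<N} \<le> sum w {..<n+N}"
      by (intro sum_mono2) (auto simp: w_def)
    also have "\<dots> \<le> sum w {..<n+N} + (n + N) * remainder_coeff n (n + N)"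
      by (simp add: remainder_coeff_nonneg)
    also have "\<dots> = 2 * n * remainder_coeff n n + (\<Sum>i<N. remainder_coeff n (n + i))"
      using remainder_coeff_sum_differences[OF assms(1), of N] by (simp add: w_def)
    also have "2 * n * remainder_coeff n n \<le> 2"
      by (simp add: remainder_coeff_same[OF assms(1)] field_simps)
    also have "(\<Sum>i<N. remainder_coeff n (n + i)) = sum (remainder_coeff n) {n..<n+N}"
      by (rule sum.reindex_bij_witness[of _ "\<lambda>i. i - n" "\<lambda>i. n + i"]) auto
    also have "\<dots> \<le> suminf (remainder_coeff n)"
      using remainder_coeff_sums_1[OF assms(1)]
      by (intro sum_le_suminf) (auto simp: sums_iff remainder_coeff_nonneg)
    also have "\<dots> = 1"
      using remainder_coeff_sums_1[OF assms(1)] by (simp add: sums_iff)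
    finally show ?thesis by simp
  qed
  show "summable w"
    using le by (intro summableI_nonneg_bounded) (auto simp: w_def)
  then show "suminf w \<le> 3"
    using le by (intro suminf_le_const)
qed

lemma A_norm_g_L_le:
  assumes "n \<ge> 1" "0 \<le> a" "a \<le> 1"
  shows "g_L n \<in> A_space a" "A_norm a (g_L n) \<le> 4"
proof -
  define h :: "nat \<Rightarrow> complex"
    where "h m = of_real ((if m = 0 then 1 else 0) - remainder_coeff n m)" for m
  define w where "w = (\<lambda>m. \<bar>remainder_coeff n m - remainder_coeff n (Suc m)\<bar> * (real m + 1))"
  note w = remainder_coeff_differences[OF assms(1), folded w_def]
  have g: "has_l1_coeffs (g_L n) h"
    using has_l1_coeffs_g_L[OF assms(1)] unfolding h_def .
  have "norm (h m - h (Suc m)) \<le> (if m = 0 then 1 else 0) + \<bar>remainder_coeff n m - remainder_coeff n (Suc m)\<bar>" for m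
    unfolding h_def of_real_diff[symmetric] norm_of_real by auto
  then have "norm (h m - h (Suc m)) * (m + 1)
      \<le> ((if m = 0 then 1 else 0) + \<bar>remainder_coeff n m - remainder_coeff n (Suc m)\<bar>) * (m + 1)" for m
    by (intro mult_right_mono) auto
  then have le: "norm (h m - h (Suc m)) * (m + 1) \<le> (if m = 0 then 1 else 0) + w m" for m
    by (rule order.trans) (auto simp: w_def algebra_simps)
  have "(\<lambda>m. (if m = 0 then 1 else 0) + w m) sums (1 + suminf w)"
    using w by (intro sums_add sums_single[of 0 "\<lambda>_. 1"] summable_sums)
  note * = this[THEN sums_summable] this[THEN sums_unique, symmetric]
  have sm: "summable (\<lambda>m. norm (h m - h (Suc m)) * (m + 1))"
    by (rule summable_comparison_test'[OF *(1), of 0]) (use le in auto)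
  note A = A_space_if_first_difference_summable[OF g assms(2,3) sm]
  show "g_L n \<in> A_space a"
    by (rule A(1))
  have "(\<Sum>m. norm (h m - h (Suc m)) * (m + 1)) \<le> 1 + suminf w"
    using suminf_le[OF le sm *(1)] unfolding *(2) .
  then show "A_norm a (g_L n) \<le> 4"
    using A(2) w by linarith
qed

lemma cesaro_k_le_Suc:
  assumes "0 \<le> a" "a \<le> 1"
  shows "cesaro_k (a + 1) n \<le> n + 1"
proof -
  have "(2 / (real n + 2)) powr (1 - a) \<le> 1"
    using assms by (intro powr_le1) auto
  then have "cesaro_k (a + 1) n / (real n + 1) \<le> 1"
    using cesaro_k_over_Suc_le[OF assms, of n] by linarith
  then show ?thesis
    by simp
qed

definition difference_coeff :: "nat \<Rightarrow> nat \<Rightarrow> real" where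
  "difference_coeff n m =
    (case m of 0 \<Rightarrow> 0 | Suc m \<Rightarrow> remainder_coeff n m - remainder_coeff n (Suc m))"

lemma difference_coeff_eq_0: "m < n \<Longrightarrow> difference_coeff n m = 0"
  by (auto simp: difference_coeff_def remainder_coeff_def split: nat.split)

lemma difference_coeff_weighted:
  assumes "n \<ge> 1"
  defines "d \<equiv> \<lambda>m. \<bar>difference_coeff n m\<bar> * (real m + 1)"
  shows "summable d" "suminf d \<le> 6"
proof -
  define w where "w = (\<lambda>m. \<bar>remainder_coeff n m - remainder_coeff n (Suc m)\<bar> * (real m + 1))"
  note w = remainder_coeff_differences[OF assms(1), folded w_def]
  have le: "d (Suc m) \<le> 2 * w m" for m
  proof -
    have "d (Suc m) \<le> \<bar>remainder_coeff n m - remainder_coeff n (Suc m)\<bar> * (2 * (real m + 1))"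
      unfolding d_def difference_coeff_def by (intro mult_mono) auto
    then show ?thesis
      by (simp add: w_def algebra_simps)
  qed
  have sm: "summable (\<lambda>m. d (Suc m))"
    by (rule summable_comparison_test'[OF summable_mult[OF w(1), of 2], of 0]) (use le in \<open>auto simp: d_def\<close>)
  then show "summable d"
    by (simp add: summable_Suc_iff)
  have "suminf d = (\<Sum>m. d (Suc m))"
    using suminf_split_head[OF \<open>summable d\<close>] by (simp add: d_def difference_coeff_def)
  also have "\<dots> \<le> (\<Sum>m. 2 * w m)"
    by (intro suminf_le le sm summable_mult w)
  also have "\<dots> \<le> 6"
    using w by (simp add: suminf_mult)
  finally show "suminf d \<le> 6" .
qed

lemma has_l1_coeffs_difference:
  assumes "n \<ge> 1"
  shows "has_l1_coeffs (\<lambda>z. (1 - z) * g_L n z - (1 - z)) (\<lambda>m. of_real (difference_coeff n m))"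
  unfolding has_l1_coeffs_def
proof (intro conjI ballI)
  show "summable (\<lambda>m. norm (complex_of_real (difference_coeff n m)))"
    by (rule summable_comparison_test'[OF difference_coeff_weighted(1)[OF assms], of 0])
       (auto simp: mult_le_cancel_left1)
  fix z :: complex assume "z \<in> cball 0 1"
  then have R: "(\<lambda>m. of_real (remainder_coeff n m) * z ^ m) sums (1 - g_L n z)"
    using remainder_coeff_sums[OF assms, of z] by simp
  have r0: "remainder_coeff n 0 = 0"
    using assms by (simp add: remainder_coeff_def)
  have "(\<lambda>m. of_real (remainder_coeff n (Suc m)) * z ^ Suc m) sums (1 - g_L n z)"
    using R by (subst sums_Suc_iff) (simp add: r0)
  from sums_diff[OF sums_mult[OF R, of z] this]
  have "(\<lambda>m. of_real (difference_coeff n (Suc m)) * z ^ Suc m) sums (z * (1 - g_L n z) - (1 - g_L n z))"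
    by (rule sums_cong[THEN iffD1, rotated]) (auto simp: difference_coeff_def algebra_simps)
  then show "(\<lambda>m. of_real (difference_coeff n m) * z ^ m) sums ((1 - z) * g_L n z - (1 - z))"
    by (subst (asm) sums_Suc_iff) (simp add: difference_coeff_def algebra_simps)
qed

lemma A_norm_difference_le:
  assumes "n \<ge> 1" "0 \<le> a" "a \<le> 1"
  shows "0 \<le> A_norm a (\<lambda>z. (1 - z) * g_L n z - (1 - z))"
    and "A_norm a (\<lambda>z. (1 - z) * g_L n z - (1 - z)) \<le> 12 * (2 / (real n + 2)) powr (1 - a)"
proof -
  define c where "c = (2 / (real n + 2)) powr (1 - a)"
  have le: "norm (of_real (difference_coeff n m) :: complex) * cesaro_k (a + 1) m
      \<le> c * (\<bar>difference_coeff n m\<bar> * (real m + 1))" for m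
  proof (cases "m < n")
    case False
    have "cesaro_k (a + 1) m / (real m + 1) \<le> (2 / (real m + 2)) powr (1 - a)"
      using assms by (intro cesaro_k_over_Suc_le)
    also have "\<dots> \<le> c"
      unfolding c_def using False assms by (intro powr_mono2) (auto simp: frac_le)
    finally have "cesaro_k (a + 1) m \<le> c * (m + 1)"
      by (simp add: field_simps)
    then have "\<bar>difference_coeff n m\<bar> * cesaro_k (a + 1) m \<le> \<bar>difference_coeff n m\<bar> * (c * (m + 1))"
      by (intro mult_left_mono) auto
    then show ?thesis
      by (simp add: mult_ac add.commute)
  qed (simp add: difference_coeff_eq_0)
  note d = difference_coeff_weighted[OF assms(1)]
  have sm: "summable (\<lambda>m. norm (of_real (difference_coeff n m) :: complex) * cesaro_k (a + 1) m)"
    by (rule summable_comparison_test'[OF summable_mult[OF d(1), of c], of 0])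
       (use le cesaro_k_nonneg[of "a + 1"] assms in auto)
  note A = A_space_if_weighted_coeffs_summable[OF has_l1_coeffs_difference[OF assms(1)] assms(2,3) sm]
  show "0 \<le> A_norm a (\<lambda>z. (1 - z) * g_L n z - (1 - z))"
    by (rule A(2))
  have "(\<Sum>m. norm (of_real (difference_coeff n m) :: complex) * cesaro_k (a + 1) m)
      \<le> (\<Sum>m. c * (\<bar>difference_coeff n m\<bar> * (real m + 1)))"
    by (intro suminf_le le sm summable_mult d)
  also have "\<dots> = c * (\<Sum>m. \<bar>difference_coeff n m\<bar> * (real m + 1))"
    by (intro suminf_mult d)
  also have "\<dots> \<le> c * 6"
    using d(2) by (intro mult_left_mono) (auto simp: c_def)
  finally show "A_norm a (\<lambda>z. (1 - z) * g_L n z - (1 - z)) \<le> 12 * (2 / (real n + 2)) powr (1 - a)"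
    using A(3) by (simp add: c_def)
qed

lemma has_l1_coeffs_one_minus:
  "has_l1_coeffs (\<lambda>z. 1 - z) (\<lambda>m. if m = 0 then 1 else if m = 1 then - 1 else 0)"
  by (rule has_l1_coeffs_polynomial[where n = 2]) (auto simp: numeral_2_eq_2)

lemma one_minus_in_A_space:
  assumes "0 \<le> a" "a \<le> 1"
  shows "(\<lambda>z. 1 - z) \<in> A_space a"
  by (rule A_space_if_weighted_coeffs_summable(1)[OF has_l1_coeffs_one_minus assms])
     (rule summable_finite[of "{0, 1}"], auto)

lemma one_minus_times_g_L_in_A_space:
  assumes "n \<ge> 1" "0 \<le> a" "a \<le> 1"
  shows "(\<lambda>z. (1 - z) * g_L n z) \<in> A_space a"
proof -
  define p :: "nat \<Rightarrow> complex" where "p m = (if m = 0 then 1 else if m = 1 then - 1 else 0)" for m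
  define e where "e m = of_real (difference_coeff n m) + p m" for m
  have g: "has_l1_coeffs (\<lambda>z. (1 - z) * g_L n z) e"
    using has_l1_coeffs_add[OF has_l1_coeffs_difference[OF assms(1)] has_l1_coeffs_one_minus]
    by (simp add: e_def[abs_def] p_def[abs_def])
  have "summable (\<lambda>m. norm (p m) * (real m + 1))"
    by (rule summable_finite[of "{0, 1}"]) (auto simp: p_def)
  from summable_add[OF difference_coeff_weighted(1)[OF assms(1)] this]
  have sm: "summable (\<lambda>m. (\<bar>difference_coeff n m\<bar> + norm (p m)) * (real m + 1))"
    by (simp add: distrib_right)
  have "norm (e m) * cesaro_k (a + 1) m \<le> (\<bar>difference_coeff n m\<bar> + norm (p m)) * (real m + 1)" for m
    using cesaro_k_le_Suc[OF assms(2,3), of m] cesaro_k_nonneg[of "a + 1" m] assms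
      norm_triangle_ineq[of "of_real (difference_coeff n m)" "p m"]
    by (intro mult_mono) (auto simp: e_def)
  then have "summable (\<lambda>m. norm (e m) * cesaro_k (a + 1) m)"
    using cesaro_k_nonneg[of "a + 1"] assms by (intro summable_comparison_test'[OF sm, of 0]) auto
  from A_space_if_weighted_coeffs_summable(1)[OF g assms(2,3) this] show ?thesis .
qed

theorem theorem3:
  shows "(\<exists>M>0. \<forall>n\<ge>1. \<forall>\<alpha>. 0 \<le> \<alpha> \<and> \<alpha> \<le> 1 \<longrightarrow>
            g_L n \<in> A_space \<alpha> \<and> A_norm \<alpha> (g_L n) \<le> M)
       \<and> (\<forall>\<alpha>. 0 \<le> \<alpha> \<and> \<alpha> < 1 \<longrightarrow>
            (\<lambda>z. 1 - z) \<in> A_space \<alpha>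
          \<and> (\<forall>n\<ge>1. (\<lambda>z. (1 - z) * g_L n z) \<in> A_space \<alpha>)
          \<and> (\<lambda>n. A_norm \<alpha> (\<lambda>z. (1 - z) * g_L n z - (1 - z))) \<longlonglongrightarrow> 0)"
proof (intro conjI allI impI exI[of _ "4 :: real"])
  fix a :: real assume a: "0 \<le> a \<and> a < 1"
  have "(\<lambda>n. 2 / (real n + 2)) \<longlonglongrightarrow> 0"
    by real_asymp
  then have "(\<lambda>n. 12 * (2 / (real n + 2)) powr (1 - a)) \<longlonglongrightarrow> 12 * 0"
    using a by (intro tendsto_mult tendsto_const tendsto_zero_powrI[where b = "1 - a"]) auto
  then have lim: "(\<lambda>n. 12 * (2 / (real n + 2)) powr (1 - a)) \<longlonglongrightarrow> 0"
    by simp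
  show "(\<lambda>n. A_norm a (\<lambda>z. (1 - z) * g_L n z - (1 - z))) \<longlonglongrightarrow> 0"
  proof (rule tendsto_sandwich[OF _ _ tendsto_const lim])
    show "\<forall>\<^sub>F n in sequentially. 0 \<le> A_norm a (\<lambda>z. (1 - z) * g_L n z - (1 - z))"
      using eventually_ge_at_top[of 1] by eventually_elim (rule A_norm_difference_le, use a in auto)
    show "\<forall>\<^sub>F n in sequentially. A_norm a (\<lambda>z. (1 - z) * g_L n z - (1 - z))
        \<le> 12 * (2 / (real n + 2)) powr (1 - a)"
      using eventually_ge_at_top[of 1] by eventually_elim (rule A_norm_difference_le, use a in auto)
  qed
qed (auto simp: A_norm_g_L_le one_minus_in_A_space one_minus_times_g_L_in_A_space)

end
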